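(* Let $p$ be a prime, let $N\simeq\mathbb{Z}^n$ be a lattice with dual $M=\mathrm{Hom}_{\mathbb{Z}}(N,\mathbb{Z})$, and let $\sigma$ be a pointed, rational, polyhedral cone in $N_{\mathbb{R}}=N\otimes_{\mathbb{Z}}\mathbb{R}$ with relative interior $\sigma^\circ$ and dual cone $\sigma^\vee\subset M_{\mathbb{R}}$. Let $\ell_1,\ell_2\in\sigma^\vee\cap M$ be such that $\sigma\cap\{v\mid \ell_2(v)=0\}=\{0\}$. For $\mathrm{Re}(s)>0$ let $$Z_{\sigma,\ell_1,\ell_2}(s)=\sum_{v\in\sigma^\circ\cap N}\left(\frac1p\right)^{\ell_1(v)s+\ell_2(v)} .$$ Then $Z_{\sigma,\ell_1,\ell_2}$ is a rational function of $\left(\frac1p\right)^s$, and therefore can be meromorphically extended to $\mathbb{C}$. Moreover, for every pole $s$ of (the extension of) $Z_{\sigma,\ell_1,\ell_2}$ there is a primitive generator $v$ of a ray (one-dimensional face) of $\sigma$, with $\ell_1(v)\neq 0$, such that $$\mathrm{Re}(s)=-\frac{\ell_2(v)}{\ell_1(v)} .$$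
   Context: A pointed cone is one containing no nonzero linear subspace. The dual cone is $\sigma^\vee=\{\ell\in M_{\mathbb{R}}\mid \ell(v)\ge 0\text{ for all }v\in\sigma\}$. The primitive generator of a ray of $\sigma$ is the unique generator of the semigroup of points of $N$ on that ray. The series defining $Z_{\sigma,\ell_1,\ell_2}$ is well-defined and holomorphic in $\{s\in\mathbb{C}\mid\mathrm{Re}(s)>0\}$. Being a rational function of $(1/p)^s$ means that there is a rational function $R(T)$ in one variable such that the function equals $R(p^{-s})$. *)

theory Defs
  imports "HOL-Complex_Analysis.Complex_Analysis" "HOL-Computational_Algebra.Polynomial"
begin

(* A lattice is realised inside a Euclidean space as the set of integral combinations of an
   R-linearly independent set of n vectors, so N is isomorphic to Z^n and N tensor R is the real
   subspace "span N".  The span need not be the whole type; in particular n = 0 is allowed. *)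
definition lattice_of_rank :: "nat \<Rightarrow> 'a::euclidean_space set \<Rightarrow> bool" where
  "lattice_of_rank n N \<longleftrightarrow>
     (\<exists>B. independent B \<and> card B = n \<and>
          N = {\<Sum>b\<in>B. real_of_int (c b) *\<^sub>R b |c. True})"

(* Elements of the dual space Hom(span N, R) are represented by linear functionals on the ambient
   space.  Every linear functional on "span N" extends to one of these, and only values on "span N"
   are ever used.  The lattice M = Hom(N, Z) consists of the functionals that are integral on N. *)
definition dual_lattice :: "'a::euclidean_space set \<Rightarrow> ('a \<Rightarrow> real) set" where
  "dual_lattice N = {l. linear l \<and> (\<forall>v\<in>N. l v \<in> \<int>)}"

definition dual_cone :: "'a::euclidean_space set \<Rightarrow> ('a \<Rightarrow> real) set" where
  "dual_cone \<sigma> = {l. linear l \<and> (\<forall>v\<in>\<sigma>. l v \<ge> 0)}"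

(* "convex_cone" requires nonemptiness, so its hull of the empty set is {0}. *)
definition rational_polyhedral_cone :: "'a::euclidean_space set \<Rightarrow> 'a set \<Rightarrow> bool" where
  "rational_polyhedral_cone N \<sigma> \<longleftrightarrow> (\<exists>S. finite S \<and> S \<subseteq> N \<and> \<sigma> = convex_cone hull S)"

definition pointed_cone :: "'a::euclidean_space set \<Rightarrow> bool" where
  "pointed_cone \<sigma> \<longleftrightarrow> (\<forall>W. subspace W \<and> W \<subseteq> \<sigma> \<longrightarrow> W = {0})"

definition ray_of :: "'a::euclidean_space set \<Rightarrow> 'a set \<Rightarrow> bool" where
  "ray_of \<rho> \<sigma> \<longleftrightarrow> \<rho> face_of \<sigma> \<and> aff_dim \<rho> = 1"

definition primitive_generator :: "'a::euclidean_space set \<Rightarrow> 'a set \<Rightarrow> 'a \<Rightarrow> bool" where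
  "primitive_generator N \<rho> v \<longleftrightarrow> \<rho> \<inter> N = range (\<lambda>k::nat. real k *\<^sub>R v)"

definition cone_zeta ::
  "nat \<Rightarrow> 'a::euclidean_space set \<Rightarrow> 'a set \<Rightarrow> ('a \<Rightarrow> real) \<Rightarrow> ('a \<Rightarrow> real) \<Rightarrow> complex \<Rightarrow> complex" where
  "cone_zeta p N \<sigma> l1 l2 s =
     (\<Sum>\<^sub>\<infinity>v \<in> rel_interior \<sigma> \<inter> N.
        (1 / of_nat p :: complex) powr (of_real (l1 v) * s + of_real (l2 v)))"

(* On A, f is R(g) for a rational function R = P/Q without poles in g ` A.  The nonvanishing of the
   denominator is demanded explicitly because of the convention x / 0 = 0. *)
definition rational_function_of_on ::
  "(complex \<Rightarrow> complex) \<Rightarrow> (complex \<Rightarrow> complex) \<Rightarrow> complex set \<Rightarrow> bool" where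
  "rational_function_of_on f g A \<longleftrightarrow>
     (\<exists>P Q :: complex poly. Q \<noteq> 0 \<and>
        (\<forall>s\<in>A. poly Q (g s) \<noteq> 0 \<and> f s = poly P (g s) / poly Q (g s)))"

(* Two such extensions agree outside a discrete set, so they have the same poles. *)
definition meromorphic_extension ::
  "(complex \<Rightarrow> complex) \<Rightarrow> (complex \<Rightarrow> complex) \<Rightarrow> complex set \<Rightarrow> bool" where
  "meromorphic_extension F f A \<longleftrightarrow> F meromorphic_on UNIV \<and> (\<forall>s\<in>A. F s = f s)"

end

theory Submission
  imports Defs
begin

text \<open>
  Let \<open>v\<^sub>1, \<dots>, v\<^sub>r\<close> be the primitive generators of the rays of \<open>\<sigma>\<close>. By Gordan's argument \<open>\<sigma> \<inter> N\<close> is a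
  finitely generated module over the monoid spanned by the \<open>v\<^sub>i\<close>, hence so is its submodule
  \<open>\<sigma>\<^sup>\<circ> \<inter> N\<close>. As in the Hilbert--Serre theorem, multiplying the generating function of a finitely
  generated module by the product of the factors \<open>1 - p\<^bsup>-l2 v\<^esup> T\<^bsup>l1 v\<^esup>\<close> over \<open>v = v\<^sub>1, \<dots>, v\<^sub>r\<close> turns it
  into a polynomial in \<open>T = p\<^bsup>-s\<^esup>\<close>. So no triangulation of \<open>\<sigma>\<close> is needed, and poles can only occur where one
  of these factors vanishes; taking absolute values there gives \<open>l2 v + l1 v * Re s = 0\<close>. Positivity
  of \<open>l2\<close> on \<open>\<sigma> - {0}\<close> is used to find the rays, to choose primitive generators, and for convergence.
\<close>

section \<open>Finitely generated modules over a monoid of vectors\<close>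

text \<open>\<open>W\<close> plays the role of the module generators and \<open>vs\<close> that of
  the variables of a polynomial ring, acting by translation. They form a list so that inductions can
  strip off one variable at a time.\<close>

primrec nat_span :: "'a::real_vector set \<Rightarrow> 'a list \<Rightarrow> 'a set" where
  "nat_span W [] = W"
| "nat_span W (v # vs) = {u + real n *\<^sub>R v |u n. u \<in> nat_span W vs}"

lemma nat_span_mono: "W \<subseteq> W' \<Longrightarrow> nat_span W vs \<subseteq> nat_span W' vs"
  by (induction vs) (simp_all, blast)

lemma nat_span_translate: "w \<in> nat_span W vs \<Longrightarrow> w + x \<in> nat_span ((\<lambda>u. u + x) ` W) vs"
proof (induction vs arbitrary: w)
  case (Cons v vs)
  then obtain u n where "w = u + real n *\<^sub>R v" "u \<in> nat_span W vs" by auto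
  moreover from this Cons.IH have "u + x \<in> nat_span ((\<lambda>u. u + x) ` W) vs" by blast
  ultimately show ?case
    by (auto intro!: exI[of _ "u + x"] exI[of _ n] simp: algebra_simps)
qed simp

lemma nat_span_add_closed:
  assumes "v \<in> set vs" "w \<in> nat_span W vs"
  shows "w + v \<in> nat_span W vs"
  using assms
proof (induction vs arbitrary: w)
  case (Cons x vs)
  then obtain u n where u: "w = u + real n *\<^sub>R x" "u \<in> nat_span W vs" by auto
  show ?case
  proof (cases "v = x")
    case True
    then show ?thesis using u
      by (auto intro!: exI[of _ u] exI[of _ "Suc n"] simp: algebra_simps)
  next
    case False
    then have "u + v \<in> nat_span W vs" using Cons u by auto
    then show ?thesis using u
      by (auto intro!: exI[of _ "u + v"] exI[of _ n] simp: algebra_simps)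
  qed
qed simp

lemma add_multiple_closed:
  fixes v :: "'a::real_vector"
  assumes "\<And>u. u \<in> D \<Longrightarrow> u + v \<in> D" "u \<in> D"
  shows "u + real n *\<^sub>R v \<in> D"
proof (induction n)
  case (Suc n)
  from assms(1)[OF this] show ?case by (simp add: algebra_simps)
qed (use assms in simp)

lemma nat_span_subset:
  assumes "W \<subseteq> D" "\<And>u v. u \<in> D \<Longrightarrow> v \<in> set vs \<Longrightarrow> u + v \<in> D"
  shows "nat_span W vs \<subseteq> D"
  using assms
proof (induction vs)
  case (Cons v vs)
  then have "nat_span W vs \<subseteq> D" by simp
  moreover have "u + real n *\<^sub>R v \<in> D" if "u \<in> D" for u n
    using add_multiple_closed[of D v u n] that Cons.prems by simp
  ultimately show ?case by auto
qed simp

text \<open>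
  The proof is that of Hilbert's basis theorem: the sets \<open>E n\<close> of "coefficients" of \<open>n v\<close> in \<open>D\<close> form
  an increasing chain, which is stationary by the induction hypothesis.
\<close>
lemma nat_span_noetherian:
  assumes "D \<subseteq> nat_span W vs" "\<And>u v. u \<in> D \<Longrightarrow> v \<in> set vs \<Longrightarrow> u + v \<in> D" "finite W"
  obtains W' where "finite W'" "W' \<subseteq> D" "D \<subseteq> nat_span W' vs"
proof -
  have "\<exists>W'. finite W' \<and> W' \<subseteq> D \<and> D \<subseteq> nat_span W' vs"
    using assms(1,2)
  proof (induction vs arbitrary: D)
    case Nil
    then show ?case using assms(3) finite_subset by auto
  next
    case (Cons v vs)
    define E where "E n = {u \<in> nat_span W vs. u + real n *\<^sub>R v \<in> D}" for n
    have closed: "u + x \<in> E n" if "u \<in> E n" "x \<in> set vs" for u x n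
    proof -
      have "u + real n *\<^sub>R v + x \<in> D"
        using that Cons.prems(2) by (auto simp: E_def)
      moreover have "u + x \<in> nat_span W vs"
        using that nat_span_add_closed by (auto simp: E_def)
      ultimately show ?thesis by (simp add: E_def algebra_simps)
    qed
    have incr: "E m \<subseteq> E n" if "m \<le> n" for m n
    proof
      fix u assume u: "u \<in> E m"
      then have "u + real m *\<^sub>R v + real (n - m) *\<^sub>R v \<in> D"
        using add_multiple_closed[of D v "u + real m *\<^sub>R v" "n - m"] Cons.prems(2)
        by (simp add: E_def)
      then show "u \<in> E n"
        using u that by (simp add: E_def of_nat_diff algebra_simps)
    qed
    have "\<exists>W'. finite W' \<and> W' \<subseteq> E n \<and> E n \<subseteq> nat_span W' vs" for n
      by (rule Cons.IH) (use closed in \<open>auto simp: E_def\<close>)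
    then obtain G where G: "\<And>n. finite (G n)" "\<And>n. G n \<subseteq> E n" "\<And>n. E n \<subseteq> nat_span (G n) vs"
      by metis
    \<comment> \<open>The union of the chain is finitely generated as well. Its finitely many
      generators already lie in a single member \<open>E m\<close>, so the chain stops growing
      there.\<close>
    have "\<exists>W'. finite W' \<and> W' \<subseteq> (\<Union>n. E n) \<and> (\<Union>n. E n) \<subseteq> nat_span W' vs"
      by (rule Cons.IH) (use closed in \<open>auto simp: E_def\<close>)
    then obtain H where H: "finite H" "H \<subseteq> (\<Union>n. E n)" "(\<Union>n. E n) \<subseteq> nat_span H vs"
      by blast
    obtain I where I: "finite I" "H \<subseteq> (\<Union>n\<in>I. E n)"
      using finite_subset_Union[OF H(1), of "range E"] H(2)
      by (metis (no_types, lifting) finite_subset_image)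
    define m where "m = Max (insert 0 I)"
    have "H \<subseteq> E m"
    proof
      fix h assume "h \<in> H"
      then obtain i where "i \<in> I" "h \<in> E i" using I by auto
      moreover have "i \<le> m" unfolding m_def using I \<open>i \<in> I\<close> by simp
      ultimately show "h \<in> E m" using incr by blast
    qed
    then have stable: "(\<Union>n. E n) \<subseteq> E m"
      using H(3) nat_span_subset[of H "E m" vs] closed by blast
    define W' where "W' = (\<Union>n\<le>m. (\<lambda>u. u + real n *\<^sub>R v) ` G n)"
    have "finite W'" using G by (simp add: W'_def)
    moreover have "W' \<subseteq> D" using G(2) by (fastforce simp: W'_def E_def)
    moreover have "D \<subseteq> nat_span W' (v # vs)"
    proof
      fix x assume "x \<in> D"
      then obtain u n where x: "x = u + real n *\<^sub>R v" and "u \<in> E n"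
        using Cons.prems(1) by (fastforce simp: E_def)
      \<comment> \<open>Beyond level \<open>m\<close> there are no new coefficients:
        \<open>u\<close> already lies in \<open>E k\<close>, so \<open>u + k v\<close> is generated
        by \<open>W'\<close>, and the other \<open>n - k\<close> copies of \<open>v\<close> come
        from the monoid.\<close>
      define k where "k = min n m"
      have "u \<in> E k"
        using stable \<open>u \<in> E n\<close> by (auto simp: k_def min_def)
      then have "u + real k *\<^sub>R v \<in> nat_span ((\<lambda>u. u + real k *\<^sub>R v) ` G k) vs"
        using G(3) nat_span_translate by blast
      also have "\<dots> \<subseteq> nat_span W' vs"
        by (rule nat_span_mono) (use min.cobounded2[of n m] in \<open>unfold W'_def k_def, blast\<close>)
      finally have "u + real k *\<^sub>R v + real (n - k) *\<^sub>R v \<in> nat_span W' (v # vs)"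
        by auto
      moreover have "u + real k *\<^sub>R v + real (n - k) *\<^sub>R v = x"
        by (simp add: x k_def of_nat_diff algebra_simps)
      ultimately show "x \<in> nat_span W' (v # vs)" by simp
    qed
    ultimately show ?case by blast
  qed
  then show ?thesis using that by blast
qed

section \<open>Absolute convergence of multiplicative functions\<close>

text \<open>Choosing one preimage for each point turns the sum over the image into a partial sum
  over \<open>A\<close>. Injectivity of \<open>h\<close> cannot be assumed in the application, where
  linearly dependent generators give a point several representations.\<close>

lemma norm_summable_on_image:
  fixes f :: "'b \<Rightarrow> 'c::real_normed_vector"
  assumes "(\<lambda>x. norm (f (h x))) summable_on A"
  shows "(\<lambda>y. norm (f y)) summable_on h ` A"
proof -
  define B where "B = inv_into A h ` h ` A"
  have "B \<subseteq> A" by (auto simp: B_def inv_into_into)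
  then have "(\<lambda>x. norm (f (h x))) summable_on B"
    using assms summable_on_subset_banach by blast
  moreover have "inj_on (inv_into A h) (h ` A)" by (simp add: inj_on_inv_into)
  ultimately have "(\<lambda>y. norm (f (h (inv_into A h y)))) summable_on h ` A"
    unfolding B_def by (subst (asm) summable_on_reindex) (simp_all add: o_def)
  then show ?thesis
    by (rule summable_on_cong[THEN iffD1, rotated]) (simp add: f_inv_into_f)
qed

lemma multiplicative_multiple:
  fixes f :: "'a::real_vector \<Rightarrow> 'b::comm_monoid_mult"
  assumes "\<And>u v. u \<in> M \<Longrightarrow> v \<in> M \<Longrightarrow> u + v \<in> M"
    and "\<And>u v. u \<in> M \<Longrightarrow> v \<in> M \<Longrightarrow> f (u + v) = f u * f v"
    and "u \<in> M" "v \<in> M"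
  shows "f (u + real n *\<^sub>R v) = f u * f v ^ n"
proof (induction n)
  case (Suc n)
  have "u + real n *\<^sub>R v \<in> M"
    by (rule add_multiple_closed) (use assms in auto)
  then have "f (u + real n *\<^sub>R v + v) = f u * f v ^ n * f v"
    using assms(2,4) Suc by metis
  then show ?case by (simp add: algebra_simps)
qed simp

text \<open>Each generator contributes a geometric series of ratio \<open>norm (f v)\<close>. Points
  represented several times are counted several times in the product, which can only increase a sum
  of norms.\<close>

lemma nat_span_norm_summable:
  fixes f :: "'a::real_vector \<Rightarrow> 'b::{real_normed_field,banach}"
  assumes M: "\<And>u v. u \<in> M \<Longrightarrow> v \<in> M \<Longrightarrow> u + v \<in> M"
    and f: "\<And>u v. u \<in> M \<Longrightarrow> v \<in> M \<Longrightarrow> f (u + v) = f u * f v"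
    and "finite W" "W \<subseteq> M" "set vs \<subseteq> M" "\<And>v. v \<in> set vs \<Longrightarrow> norm (f v) < 1"
  shows "(\<lambda>a. norm (f a)) summable_on nat_span W vs"
  using assms(5,6)
proof (induction vs)
  case Nil
  then show ?case using \<open>finite W\<close> by simp
next
  case (Cons v vs)
  have sub: "nat_span W vs \<subseteq> M"
    by (rule nat_span_subset) (use assms(4) Cons.prems M in auto)
  have v: "v \<in> M" "norm (f v) < 1" using Cons.prems by auto
  have eq: "f (u + real n *\<^sub>R v) = f u * f v ^ n" if "u \<in> nat_span W vs" for u n
    by (rule multiplicative_multiple) (use sub that v M f in auto)
  have "(\<lambda>(u, n). norm (f u) * norm (f v) ^ n) summable_on nat_span W vs \<times> UNIV"
  proof (rule summable_on_SigmaI)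
    show "((\<lambda>n. case (u, n) of (u, n) \<Rightarrow> norm (f u) * norm (f v) ^ n)
            has_sum norm (f u) * (1 / (1 - norm (f v)))) UNIV" for u
      using sums_mult[OF geometric_sums[of "norm (f v)"], of "norm (f u)"] v
      by (intro norm_summable_imp_has_sum)
         (auto intro!: summable_mult summable_geometric simp: norm_mult norm_power)
    have "(\<lambda>u. norm (f u)) summable_on nat_span W vs" using Cons by simp
    then show "(\<lambda>u. norm (f u) * (1 / (1 - norm (f v)))) summable_on nat_span W vs"
      by (rule summable_on_cmult_left)
  qed auto
  then have "(\<lambda>x. norm (f (case x of (u, n) \<Rightarrow> u + real n *\<^sub>R v))) summable_on nat_span W vs \<times> UNIV"
    by (rule summable_on_cong[THEN iffD1, rotated]) (auto simp: eq norm_mult norm_power)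
  moreover have "nat_span W (v # vs) = (\<lambda>(u, n). u + real n *\<^sub>R v) ` (nat_span W vs \<times> UNIV)"
    by (auto simp: image_iff)
  ultimately show ?case
    using norm_summable_on_image[where f = f] by metis
qed

section \<open>The Hilbert--Serre argument\<close>

lemma mem_translate_iff: "x \<in> (\<lambda>c. c + v) ` C \<longleftrightarrow> x - v \<in> C" for v :: "'a::ab_group_add"
proof
  assume "x - v \<in> C"
  then show "x \<in> (\<lambda>c. c + v) ` C" by (rule rev_image_eqI) simp
qed auto

text \<open>Since \<open>f v * infsum f C\<close> is the sum over \<open>C + v\<close>, the
  contributions of \<open>C \<inter> (C + v)\<close> cancel. What remains are the cokernel and the
  kernel of multiplication by \<open>v\<close> on the module with monomials \<open>C\<close>; this
  is the Euler characteristic step of Hilbert--Serre.\<close>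

lemma infsum_translate_diff:
  fixes f :: "'a::real_vector \<Rightarrow> complex"
  assumes summ: "f summable_on M" and C: "C \<subseteq> M" and Cv: "(\<lambda>c. c + v) ` C \<subseteq> M"
    and f: "\<And>c. c \<in> C \<Longrightarrow> f (c + v) = f c * f v"
  shows "(1 - f v) * infsum f C =
    infsum f {c \<in> C. c - v \<notin> C} - f v * infsum f {c \<in> C. c + v \<notin> C}"
proof -
  have sub: "f summable_on X" if "X \<subseteq> M" for X
    using summ that summable_on_subset_banach by blast
  have shift: "infsum f ((\<lambda>c. c + v) ` X) = f v * infsum f X" if "X \<subseteq> C" for X
  proof -
    have "infsum f ((\<lambda>c. c + v) ` X) = infsum (\<lambda>c. f v * f c) X"
      by (subst infsum_reindex) (use that f in \<open>auto intro!: infsum_cong simp: o_def\<close>)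
    then show ?thesis by (simp add: infsum_cmult_right')
  qed
  let ?I = "C \<inter> (\<lambda>c. c + v) ` C"
  have "C = {c \<in> C. c - v \<notin> C} \<union> ?I" "{c \<in> C. c - v \<notin> C} \<inter> ?I = {}"
    unfolding set_eq_iff Int_iff Un_iff mem_Collect_eq mem_translate_iff by blast+
  moreover have "infsum f ({c \<in> C. c - v \<notin> C} \<union> ?I) = infsum f {c \<in> C. c - v \<notin> C} + infsum f ?I"
    by (rule infsum_Un_disjoint) (use C calculation(2) in \<open>auto intro!: sub\<close>)
  ultimately have 1: "infsum f C = infsum f {c \<in> C. c - v \<notin> C} + infsum f ?I"
    by simp
  have "(\<lambda>c. c + v) ` C = (\<lambda>c. c + v) ` {c \<in> C. c + v \<notin> C} \<union> ?I" by auto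
  moreover have "infsum f ((\<lambda>c. c + v) ` {c \<in> C. c + v \<notin> C} \<union> ?I) =
      infsum f ((\<lambda>c. c + v) ` {c \<in> C. c + v \<notin> C}) + infsum f ?I"
    by (rule infsum_Un_disjoint) (use C Cv in \<open>auto intro!: sub\<close>)
  ultimately have "f v * infsum f C = f v * infsum f {c \<in> C. c + v \<notin> C} + infsum f ?I"
    using shift[of C] shift[of "{c \<in> C. c + v \<notin> C}"] by simp
  with 1 show ?thesis by (simp add: algebra_simps)
qed

text \<open>
  The difference \<open>A - B\<close> is the set of monomials of a quotient module. On it, multiplication by the
  first generator has kernel \<open>{a \<in> A. a + v \<in> B} - B\<close> and cokernel \<open>A - (B \<union> (A + v))\<close>, both killed by
  that generator and hence finitely generated over the remaining ones.
\<close>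
lemma hilbert_serre:
  fixes z :: "'a::real_vector \<Rightarrow> complex" and d :: "'a \<Rightarrow> nat"
  assumes M: "\<And>u v. u \<in> M \<Longrightarrow> v \<in> M \<Longrightarrow> u + v \<in> M"
    and d: "\<And>u v. u \<in> M \<Longrightarrow> v \<in> M \<Longrightarrow> d (u + v) = d u + d v"
    and z: "\<And>u v. u \<in> M \<Longrightarrow> v \<in> M \<Longrightarrow> z (u + v) = z u * z v"
    and summ: "\<And>T. T \<in> D \<Longrightarrow> (\<lambda>a. z a * T ^ d a) summable_on M"
    and "set vs \<subseteq> M" "A \<subseteq> M" "finite W" "W \<subseteq> A" "A - B \<subseteq> nat_span W vs"
    and "\<And>a v. a \<in> A \<Longrightarrow> v \<in> set vs \<Longrightarrow> a + v \<in> A"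
    and "\<And>b v. b \<in> B \<Longrightarrow> v \<in> set vs \<Longrightarrow> b + v \<in> B"
  shows "\<exists>P. \<forall>T\<in>D. (\<Prod>v\<leftarrow>vs. 1 - z v * T ^ d v) * (\<Sum>\<^sub>\<infinity>a\<in>A - B. z a * T ^ d a) = poly P T"
  using assms(5-11)
proof (induction vs arbitrary: W A B)
  case Nil
  then have "finite (A - B)" by (simp add: finite_subset)
  then show ?case
    by (intro exI[of _ "\<Sum>a\<in>A - B. monom (z a) (d a)"]) (simp add: poly_sum poly_monom)
next
  case (Cons v vs)
  define C where "C = A - B"
  have v: "v \<in> M" and Av: "\<And>a. a \<in> A \<Longrightarrow> a + v \<in> A" and Bv: "\<And>b. b \<in> B \<Longrightarrow> b + v \<in> B"
    using Cons.prems by auto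
  define A' where "A' = {a \<in> A. a + v \<in> B}"
  \<comment> \<open>If \<open>v\<close> maps \<open>X\<close> into \<open>Y\<close>, a
    representation of a point of \<open>X - Y\<close> cannot involve \<open>v\<close>: with one copy
    removed it still lies in \<open>X\<close>, so the point itself would lie in
    \<open>Y\<close>.\<close>
  have drop_v: "X - Y \<subseteq> nat_span V vs"
    if V: "V \<subseteq> X" "X - Y \<subseteq> nat_span V (v # vs)" "\<And>x. x \<in> X \<Longrightarrow> x + v \<in> Y"
      "\<And>x w. x \<in> X \<Longrightarrow> w \<in> set (v # vs) \<Longrightarrow> x + w \<in> X" for V X Y
  proof
    fix c assume c: "c \<in> X - Y"
    then obtain u n where u: "c = u + real n *\<^sub>R v" "u \<in> nat_span V vs" using V(2) by auto
    have "nat_span V vs \<subseteq> X" by (rule nat_span_subset) (use V in auto)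
    with u have "u + real m *\<^sub>R v \<in> X" for m
      by (intro add_multiple_closed) (use V in auto)
    with V(3) have "u + real m *\<^sub>R v + v \<in> Y" for m by blast
    with c u have "n \<noteq> Suc m" for m by (auto simp: algebra_simps)
    then have "n = 0" using not0_implies_Suc by blast
    with u show "c \<in> nat_span V vs" by simp
  qed
  have coker: "{c \<in> C. c - v \<notin> C} = A - (B \<union> (\<lambda>a. a + v) ` A)"
  proof -
    have "c - v \<in> B \<Longrightarrow> c \<in> B" for c using Bv[of "c - v"] by simp
    then show ?thesis
      unfolding C_def set_eq_iff Diff_iff Un_iff mem_Collect_eq mem_translate_iff by blast
  qed
  have ker: "{c \<in> C. c + v \<notin> C} = A' - B"
    using Av by (auto simp: C_def A'_def)
  have "\<exists>P. \<forall>T\<in>D. (\<Prod>v\<leftarrow>vs. 1 - z v * T ^ d v) *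
      (\<Sum>\<^sub>\<infinity>a\<in>A - (B \<union> (\<lambda>a. a + v) ` A). z a * T ^ d a) = poly P T"
  proof (rule Cons.IH)
    show "A - (B \<union> (\<lambda>a. a + v) ` A) \<subseteq> nat_span W vs"
      by (rule drop_v) (use Cons.prems in auto)
    show "b + w \<in> B \<union> (\<lambda>a. a + v) ` A" if bw: "b \<in> B \<union> (\<lambda>a. a + v) ` A" "w \<in> set vs" for b w
    proof (cases "b \<in> B")
      case False
      then obtain a where "a \<in> A" "b = a + v" using bw by auto
      then have "b + w = (a + w) + v" "a + w \<in> A" using Cons.prems(6) bw by auto
      then show ?thesis by blast
    qed (use Cons.prems(7) bw in auto)
  qed (use Cons.prems in auto)
  then obtain P where P: "\<And>T. T \<in> D \<Longrightarrow> (\<Prod>v\<leftarrow>vs. 1 - z v * T ^ d v) *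
      (\<Sum>\<^sub>\<infinity>a\<in>{c \<in> C. c - v \<notin> C}. z a * T ^ d a) = poly P T"
    unfolding coker by blast
  have A'_closed: "a + w \<in> A'" if "a \<in> A'" "w \<in> set (v # vs)" for a w
  proof -
    have "a + v + w \<in> B" "a + w \<in> A"
      using that Cons.prems(6)[of a w] Cons.prems(7)[of "a + v" w] by (auto simp: A'_def)
    then show ?thesis by (simp add: A'_def algebra_simps)
  qed
  \<comment> \<open>Only \<open>A - B\<close> is known to lie in a finitely generated set, not
    \<open>A'\<close>. Intersecting with \<open>nat_span W (v # vs)\<close> makes the Noetherian
    property applicable and loses no point of \<open>A' - B\<close>.\<close>
  obtain W' where W': "finite W'" "W' \<subseteq> A' \<inter> nat_span W (v # vs)"
    "A' \<inter> nat_span W (v # vs) \<subseteq> nat_span W' (v # vs)"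
  proof (rule nat_span_noetherian)
    show "u + w \<in> A' \<inter> nat_span W (v # vs)"
      if "u \<in> A' \<inter> nat_span W (v # vs)" "w \<in> set (v # vs)" for u w
      using that A'_closed nat_span_add_closed by blast
  qed (use \<open>finite W\<close> in auto)
  have "\<exists>P. \<forall>T\<in>D. (\<Prod>v\<leftarrow>vs. 1 - z v * T ^ d v) * (\<Sum>\<^sub>\<infinity>a\<in>A' - B. z a * T ^ d a) = poly P T"
  proof (rule Cons.IH)
    have "A' - B \<subseteq> nat_span W' (v # vs)"
      using W'(3) Cons.prems(5) by (auto simp: A'_def)
    then show "A' - B \<subseteq> nat_span W' vs"
      by (intro drop_v) (use W'(2) A'_closed in \<open>auto simp: A'_def\<close>)
  qed (use Cons.prems W' A'_closed in \<open>auto simp: A'_def\<close>)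
  then obtain P' where P': "\<And>T. T \<in> D \<Longrightarrow> (\<Prod>v\<leftarrow>vs. 1 - z v * T ^ d v) *
      (\<Sum>\<^sub>\<infinity>a\<in>{c \<in> C. c + v \<notin> C}. z a * T ^ d a) = poly P' T"
    unfolding ker by blast
  show ?case
  proof (intro exI ballI)
    fix T assume T: "T \<in> D"
    let ?f = "\<lambda>a. z a * T ^ d a" and ?Q = "\<Prod>v\<leftarrow>vs. 1 - z v * T ^ d v"
    have CM: "C \<subseteq> M" using Cons.prems(2) by (auto simp: C_def)
    have "(1 - ?f v) * infsum ?f C =
        infsum ?f {c \<in> C. c - v \<notin> C} - ?f v * infsum ?f {c \<in> C. c + v \<notin> C}"
    proof (rule infsum_translate_diff[OF summ[OF T] CM])
      show "?f (c + v) = ?f c * ?f v" if "c \<in> C" for c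
        using d[of c v] z[of c v] that CM v by (auto simp: power_add)
    qed (use CM M v in auto)
    then have "?Q * ((1 - ?f v) * infsum ?f C) =
        ?Q * infsum ?f {c \<in> C. c - v \<notin> C} - ?f v * (?Q * infsum ?f {c \<in> C. c + v \<notin> C})"
      by (simp add: right_diff_distrib mult.left_commute)
    then show "(\<Prod>v\<leftarrow>v # vs. 1 - z v * T ^ d v) * infsum ?f (A - B) =
        poly (P - monom (z v) (d v) * P') T"
      using P[OF T] P'[OF T] by (simp add: C_def poly_monom mult_ac)
  qed
qed

section \<open>Rays and primitive generators of a polyhedral cone\<close>

lemma convex_cone_hull_finite:
  fixes S :: "'a::real_vector set"
  assumes "finite S"
  shows "convex_cone hull S = {\<Sum>v\<in>S. c v *\<^sub>R v |c. \<forall>v\<in>S. 0 \<le> c v}" (is "_ = ?C")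
proof (rule hull_unique)
  show "S \<subseteq> ?C"
  proof
    fix v assume "v \<in> S"
    then have "(\<Sum>w\<in>S. (if w = v then 1 else 0) *\<^sub>R w) = v"
      using assms by (simp add: if_distrib[of "\<lambda>c. c *\<^sub>R _"] sum.delta cong: if_cong)
    then show "v \<in> ?C"
      by (intro CollectI exI[of _ "\<lambda>w. if w = v then 1 else 0"]) simp
  qed
  have "(\<Sum>v\<in>S. a v *\<^sub>R v) + (\<Sum>v\<in>S. b v *\<^sub>R v) \<in> ?C"
    if "\<forall>v\<in>S. 0 \<le> a v" "\<forall>v\<in>S. 0 \<le> b v" for a b
    using that by (auto intro!: exI[of _ "\<lambda>v. a v + b v"] simp: sum.distrib scaleR_add_left)
  moreover have "t *\<^sub>R (\<Sum>v\<in>S. a v *\<^sub>R v) \<in> ?C" if "\<forall>v\<in>S. 0 \<le> a v" "t \<ge> 0" for a t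
    using that by (auto intro!: exI[of _ "\<lambda>v. t * a v"] simp: scaleR_sum_right)
  moreover have "0 \<in> ?C" by (auto intro!: exI[of _ "\<lambda>_. 0"])
  ultimately show "convex_cone ?C" unfolding convex_cone_iff by blast
  fix T assume T: "S \<subseteq> T" "convex_cone T"
  have "(\<Sum>v\<in>S'. c v *\<^sub>R v) \<in> T" if "S' \<subseteq> S" "\<forall>v\<in>S. 0 \<le> c v" for c S'
    using finite_subset[OF that(1) assms] that(1)
  proof (induction S')
    case empty
    then show ?case using T convex_cone_contains_0 by simp
  next
    case (insert v F)
    then show ?case
      using T that(2) by (auto intro!: convex_cone_add convex_cone_scaleR)
  qed
  then show "?C \<subseteq> T" by blast
qed

text \<open>Let \<open>a + b = t v\<close> with \<open>a\<close>, \<open>b\<close> in the cone.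
  Moving all multiples of \<open>v\<close> to the right leaves \<open>a' + b' = r v\<close> with
  \<open>a'\<close>, \<open>b'\<close> in the cone of the other generators. If \<open>r > 0\<close>,
  then \<open>v\<close> would lie in that cone; if \<open>r \<le> 0\<close>, positivity of
  \<open>l\<close> forces \<open>a' = 0\<close>, so \<open>a\<close> is on the ray.\<close>

lemma extremal_generator_ray:
  fixes S :: "'a::euclidean_space set" and l :: "'a \<Rightarrow> real"
  assumes "finite S" "v \<in> S" and v: "v \<notin> convex_cone hull (S - {v})"
    and "linear l" and pos: "\<And>x. x \<in> convex_cone hull S \<Longrightarrow> x \<noteq> 0 \<Longrightarrow> l x > 0"
  shows "ray_of {t *\<^sub>R v |t. 0 \<le> t} (convex_cone hull S)"
proof -
  interpret l: linear l by fact
  let ?\<rho> = "{t *\<^sub>R v |t. 0 \<le> t}" and ?\<sigma> = "convex_cone hull S"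
  have "v \<noteq> 0" using v convex_cone_hull_contains_0 by metis
  have "v \<in> ?\<sigma>" using \<open>v \<in> S\<close> hull_inc by metis
  then have sub: "?\<rho> \<subseteq> ?\<sigma>" using convex_cone_hull_mul by blast
  have \<rho>: "?\<rho> = convex_cone hull {v}"
    by (subst convex_cone_hull_finite) auto
  have sums_in_\<rho>: "a \<in> ?\<rho>" if ab: "a \<in> ?\<sigma>" "b \<in> ?\<sigma>" "a + b \<in> ?\<rho>" for a b
  proof -
    obtain t where t: "a + b = t *\<^sub>R v" "0 \<le> t" using ab(3) by blast
    obtain \<alpha> where \<alpha>: "a = (\<Sum>w\<in>S. \<alpha> w *\<^sub>R w)" "\<forall>w\<in>S. 0 \<le> \<alpha> w"
      using ab(1) convex_cone_hull_finite[OF \<open>finite S\<close>] by auto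
    obtain \<beta> where \<beta>: "b = (\<Sum>w\<in>S. \<beta> w *\<^sub>R w)" "\<forall>w\<in>S. 0 \<le> \<beta> w"
      using ab(2) convex_cone_hull_finite[OF \<open>finite S\<close>] by auto
    let ?a = "\<Sum>w\<in>S - {v}. \<alpha> w *\<^sub>R w" and ?b = "\<Sum>w\<in>S - {v}. \<beta> w *\<^sub>R w"
    let ?r = "t - \<alpha> v - \<beta> v"
    have a: "a = \<alpha> v *\<^sub>R v + ?a" and b: "b = \<beta> v *\<^sub>R v + ?b"
      using sum.remove[OF assms(1,2)] \<alpha>(1) \<beta>(1) by auto
    then have eq: "?a + ?b = ?r *\<^sub>R v" using t(1) by (simp add: algebra_simps)
    have mem: "?a \<in> convex_cone hull (S - {v})" "?b \<in> convex_cone hull (S - {v})"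
      using \<alpha>(2) \<beta>(2) \<open>finite S\<close> by (subst convex_cone_hull_finite; auto)+
    have "?r \<le> 0"
    proof (rule ccontr)
      assume "\<not> ?r \<le> 0"
      then have "v = (1 / ?r) *\<^sub>R (?a + ?b)" by (subst eq) simp
      also have "\<dots> \<in> convex_cone hull (S - {v})"
        using mem \<open>\<not> ?r \<le> 0\<close> by (intro convex_cone_hull_mul convex_cone_hull_add) auto
      finally show False using v by blast
    qed
    moreover have "l v > 0" using pos \<open>v \<in> ?\<sigma>\<close> \<open>v \<noteq> 0\<close> by blast
    moreover have "l ?a + l ?b = ?r * l v"
      using arg_cong[OF eq, of l] by (simp only: l.add l.scaleR real_scaleR_def)
    ultimately have "l ?a + l ?b \<le> 0" by (simp add: mult_nonpos_nonneg)
    moreover have "?a \<in> ?\<sigma>" "?b \<in> ?\<sigma>"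
      using mem hull_mono[of "S - {v}" S convex_cone] by blast+
    then have "l ?b \<ge> 0" "?a \<noteq> 0 \<Longrightarrow> l ?a > 0" using pos[of ?b] pos[of ?a] l.zero by fastforce+
    ultimately have "?a = 0" by fastforce
    then have "a = \<alpha> v *\<^sub>R v" using a by simp
    then show "a \<in> ?\<rho>" using \<alpha>(2) \<open>v \<in> S\<close> by blast
  qed
  have "?\<rho> face_of ?\<sigma>"
    unfolding face_of_def
  proof (intro conjI ballI impI)
    show "convex ?\<rho>" unfolding \<rho> by (rule convex_convex_cone_hull)
    fix a b x assume ab: "a \<in> ?\<sigma>" "b \<in> ?\<sigma>" "x \<in> ?\<rho>" "x \<in> open_segment a b"
    then obtain u where u: "0 < u" "u < 1" "x = (1 - u) *\<^sub>R a + u *\<^sub>R b"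
      by (auto simp: in_segment)
    \<comment> \<open>Absorbing the weights of the convex combination into the endpoints reduces the
      face condition to sums; dividing by the weights afterwards stays on the ray.\<close>
    let ?a = "(1 - u) *\<^sub>R a" and ?b = "u *\<^sub>R b"
    have "?a \<in> ?\<sigma>" "?b \<in> ?\<sigma>" using ab u by (auto intro: convex_cone_hull_mul)
    then have "?a \<in> ?\<rho>" "?b \<in> ?\<rho>"
      using sums_in_\<rho>[of ?a ?b] sums_in_\<rho>[of ?b ?a] ab(3) u(3) by (auto simp: add.commute)
    then have "(1 / (1 - u)) *\<^sub>R ?a \<in> ?\<rho>" "(1 / u) *\<^sub>R ?b \<in> ?\<rho>"
      using u unfolding \<rho> by (auto intro!: convex_cone_hull_mul simp del: scaleR_scaleR)
    then show "a \<in> ?\<rho>" "b \<in> ?\<rho>" using u by simp_all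
  qed (use sub in auto)
  moreover have "aff_dim ?\<rho> = 1"
  proof -
    have "0 \<in> ?\<rho>" by (auto intro: exI[of _ 0])
    then have "aff_dim ?\<rho> = int (dim ?\<rho>)" by (intro aff_dim_zero hull_inc)
    also have "span ?\<rho> = span {v}"
    proof (rule span_eq[THEN iffD2], intro conjI)
      show "{v} \<subseteq> span ?\<rho>" by (auto intro!: span_base exI[of _ 1])
      show "?\<rho> \<subseteq> span {v}" by (auto simp: span_singleton)
    qed
    then have "dim ?\<rho> = dim {v}" by (rule span_eq_dim)
    also have "dim {v} = 1" using \<open>v \<noteq> 0\<close> by (simp add: dim_singleton)
    finally show ?thesis by simp
  qed
  ultimately show ?thesis by (simp add: ray_of_def)
qed

lemma primitive_generator_exists:
  fixes N :: "'a::euclidean_space set" and l :: "'a \<Rightarrow> real"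
  assumes "0 \<in> N" and diff: "\<And>u v. u \<in> N \<Longrightarrow> v \<in> N \<Longrightarrow> u - v \<in> N"
    and "linear l" and int: "\<And>w. w \<in> N \<Longrightarrow> l w \<in> \<int>" and v: "v \<in> N" "l v > 0"
  obtains r where "r > 0" "r *\<^sub>R v \<in> N" "primitive_generator N {t *\<^sub>R v |t. 0 \<le> t} (r *\<^sub>R v)"
proof -
  interpret l: linear l by fact
  have mult: "real n *\<^sub>R w \<in> N" if "w \<in> N" for n w
    using add_multiple_closed[of N w 0 n] that diff \<open>0 \<in> N\<close>
    by (metis add_0 diff_0 diff_minus_eq_add)
  \<comment> \<open>The primitive generator is the nonzero point of the ray where \<open>l\<close> is smallest.\<close>
  define K where "K k \<longleftrightarrow> (\<exists>t>0. t *\<^sub>R v \<in> N \<and> l (t *\<^sub>R v) = real k)" for k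
  have K: "\<exists>k. K k \<and> real k = t * l v" if "t > 0" "t *\<^sub>R v \<in> N" for t
  proof -
    have "t * l v \<in> \<int>" "t * l v > 0" using int[OF that(2)] that v by (auto simp: l.scaleR)
    then obtain k where "t * l v = real k" by (metis Ints_cases less_imp_le of_int_0_le_iff
          of_int_of_nat_eq zero_le_imp_eq_int)
    then show ?thesis using that unfolding K_def by (auto simp: l.scaleR)
  qed
  then obtain k where "K k" "\<And>j. K j \<Longrightarrow> k \<le> j"
    using v K[of 1] exists_least_iff[of K] by (metis not_le scaleR_one zero_less_one)
  then obtain r where r: "r > 0" "r *\<^sub>R v \<in> N" "r * l v = real k"
    unfolding K_def by (auto simp: l.scaleR)
  have least: "r \<le> t" if t: "t > 0" "t *\<^sub>R v \<in> N" for t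
  proof -
    obtain j where "K j" "real j = t * l v" using K[OF t] by blast
    then have "r * l v \<le> t * l v" using \<open>K j \<Longrightarrow> k \<le> j\<close> r(3) by simp
    then show ?thesis using v(2) by simp
  qed
  have "{t *\<^sub>R v |t. 0 \<le> t} \<inter> N = range (\<lambda>k. real k *\<^sub>R r *\<^sub>R v)"
  proof (intro equalityI subsetI)
    fix w assume "w \<in> {t *\<^sub>R v |t. 0 \<le> t} \<inter> N"
    then obtain t where t: "w = t *\<^sub>R v" "0 \<le> t" "w \<in> N" by blast
    \<comment> \<open>Division with remainder: \<open>(t - m r) v\<close> is a lattice point on the
      ray with parameter in \<open>[0, r)\<close>, so it vanishes by minimality of
      \<open>r\<close>.\<close>
    define m where "m = nat \<lfloor>t / r\<rfloor>"
    have m: "real m \<le> t / r" "t / r < real m + 1"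
      using t r by (auto simp: m_def of_nat_nat)
    have "(t - real m * r) *\<^sub>R v \<in> N"
      using diff[OF t(3) mult[OF r(2), of m]] t(1) by (simp add: algebra_simps)
    then have "\<not> t - real m * r > 0"
      using least[of "t - real m * r"] m r(1) by (fastforce simp: field_simps)
    then have "t = real m * r" using m r(1) by (simp add: field_simps)
    then show "w \<in> range (\<lambda>k. real k *\<^sub>R r *\<^sub>R v)" using t(1) by auto
  qed (use r mult[OF r(2)] in \<open>auto intro!: exI[of _ "_ * r"]\<close>)
  then show ?thesis using that r by (auto simp: primitive_generator_def)
qed

lemma cone_primitive_generators:
  fixes N \<sigma> :: "'a::euclidean_space set" and l :: "'a \<Rightarrow> real"
  assumes "rational_polyhedral_cone N \<sigma>"
    and N: "0 \<in> N" "\<And>u v. u \<in> N \<Longrightarrow> v \<in> N \<Longrightarrow> u - v \<in> N"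
    and l: "linear l" "\<And>w. w \<in> N \<Longrightarrow> l w \<in> \<int>"
    and pos: "\<And>x. x \<in> \<sigma> \<Longrightarrow> x \<noteq> 0 \<Longrightarrow> l x > 0"
  obtains V where "finite V" "V \<subseteq> N" "\<sigma> = convex_cone hull V"
    "\<forall>v\<in>V. v \<noteq> 0 \<and> (\<exists>\<rho>. ray_of \<rho> \<sigma> \<and> primitive_generator N \<rho> v)"
proof -
  \<comment> \<open>Every element of a generating set of minimal cardinality spans a ray.\<close>
  define good where "good S \<longleftrightarrow> finite S \<and> S \<subseteq> N \<and> \<sigma> = convex_cone hull S" for S
  obtain S where S: "good S" "\<And>S'. good S' \<Longrightarrow> card S \<le> card S'"
    using assms(1) ex_has_least_nat[of good _ card]
    unfolding rational_polyhedral_cone_def good_def by metis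
  have S': "finite S" "S \<subseteq> N" "\<sigma> = convex_cone hull S" using S(1) by (auto simp: good_def)
  have extremal: "v \<notin> convex_cone hull (S - {v})" if "v \<in> S" for v
  proof
    assume v: "v \<in> convex_cone hull (S - {v})"
    have "S \<subseteq> convex_cone hull (S - {v})"
      using v hull_subset[of "S - {v}" convex_cone] by blast
    then have "convex_cone hull S \<subseteq> convex_cone hull (S - {v})"
      by (rule hull_minimal) (rule convex_cone_convex_cone_hull)
    then have "good (S - {v})"
      using S' hull_mono[of "S - {v}" S convex_cone] by (auto simp: good_def)
    from S(2)[OF this] card_Diff1_less[OF S'(1) that] show False by simp
  qed
  have "\<exists>r>0. r *\<^sub>R v \<in> N \<and> primitive_generator N {t *\<^sub>R v |t. 0 \<le> t} (r *\<^sub>R v)"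
    if "v \<in> S" for v
  proof -
    have "v \<in> \<sigma>" using that S' hull_inc by metis
    moreover have "v \<noteq> 0" using extremal[OF that] convex_cone_hull_contains_0 by metis
    ultimately have "l v > 0" by (rule pos)
    obtain t where "t > 0" "t *\<^sub>R v \<in> N"
        "primitive_generator N {t *\<^sub>R v |t. 0 \<le> t} (t *\<^sub>R v)"
      by (rule primitive_generator_exists[of N l v])
         (use N l \<open>v \<in> S\<close> \<open>l v > 0\<close> S'(2) in auto)
    then show ?thesis by blast
  qed
  then have "\<forall>v\<in>S. \<exists>r. r > 0 \<and> r *\<^sub>R v \<in> N \<and>
      primitive_generator N {t *\<^sub>R v |t. 0 \<le> t} (r *\<^sub>R v)" by blast
  from bchoice[OF this]
  obtain r where r: "\<And>v. v \<in> S \<Longrightarrow> r v > 0" "\<And>v. v \<in> S \<Longrightarrow> r v *\<^sub>R v \<in> N"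
    "\<And>v. v \<in> S \<Longrightarrow> primitive_generator N {t *\<^sub>R v |t. 0 \<le> t} (r v *\<^sub>R v)"
    by blast
  \<comment> \<open>Positive rescaling preserves both the cone and its rays, so the minimal
    generators may be replaced by primitive ones.\<close>
  define V where "V = (\<lambda>v. r v *\<^sub>R v) ` S"
  have "convex_cone hull V \<subseteq> convex_cone hull S"
  proof (rule hull_minimal)
    have "r v *\<^sub>R v \<in> convex_cone hull S" if "v \<in> S" for v
      using r(1)[OF that] that by (intro convex_cone_hull_mul hull_inc) auto
    then show "V \<subseteq> convex_cone hull S" by (auto simp: V_def)
  qed (rule convex_cone_convex_cone_hull)
  moreover have "convex_cone hull S \<subseteq> convex_cone hull V"
  proof (rule hull_minimal)
    show "S \<subseteq> convex_cone hull V"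
    proof
      fix v assume "v \<in> S"
      then have "(1 / r v) *\<^sub>R r v *\<^sub>R v \<in> convex_cone hull V"
        using r(1) by (intro convex_cone_hull_mul hull_inc) (auto simp: V_def less_imp_le)
      then show "v \<in> convex_cone hull V" using r(1)[OF \<open>v \<in> S\<close>] by simp
    qed
  qed (rule convex_cone_convex_cone_hull)
  ultimately have "\<sigma> = convex_cone hull V" using S'(3) by blast
  moreover have "w \<noteq> 0 \<and> (\<exists>\<rho>. ray_of \<rho> \<sigma> \<and> primitive_generator N \<rho> w)" if "w \<in> V" for w
  proof -
    obtain v where v: "v \<in> S" "w = r v *\<^sub>R v" using \<open>w \<in> V\<close> by (auto simp: V_def)
    have "v \<noteq> 0" using extremal[OF v(1)] convex_cone_hull_contains_0 by metis
    moreover have "ray_of {t *\<^sub>R v |t. 0 \<le> t} \<sigma>"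
      unfolding S'(3)
      by (rule extremal_generator_ray[where l = l]) (use S' v extremal l pos in auto)
    ultimately show ?thesis using v r(1,3)[OF v(1)] by auto
  qed
  moreover have "finite V" "V \<subseteq> N" using S' r(2) by (auto simp: V_def)
  ultimately show ?thesis using that by blast
qed

section \<open>Lattice points in cones and Gordan's lemma\<close>

lemma lattice_diff:
  assumes "lattice_of_rank n N" "u \<in> N" "v \<in> N"
  shows "u - v \<in> N"
proof -
  obtain B where N: "N = {\<Sum>b\<in>B. real_of_int (c b) *\<^sub>R b |c. True}"
    using assms(1) unfolding lattice_of_rank_def by blast
  obtain c d where "u = (\<Sum>b\<in>B. real_of_int (c b) *\<^sub>R b)" "v = (\<Sum>b\<in>B. real_of_int (d b) *\<^sub>R b)"
    using assms(2,3) N by blast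
  then have "u - v = (\<Sum>b\<in>B. real_of_int (c b - d b) *\<^sub>R b)"
    by (simp add: sum_subtractf scaleR_diff_left)
  then show ?thesis unfolding N by (intro CollectI exI[of _ "\<lambda>b. c b - d b"] conjI TrueI)
qed

lemma zero_mem_lattice: "lattice_of_rank n N \<Longrightarrow> 0 \<in> N"
  unfolding lattice_of_rank_def by (auto intro!: exI[of _ "\<lambda>_. 0"])

lemma lattice_add:
  assumes "lattice_of_rank n N" "u \<in> N" "v \<in> N"
  shows "u + v \<in> N"
  using lattice_diff[OF assms(1,2) lattice_diff[OF assms(1) zero_mem_lattice[OF assms(1)] assms(3)]]
  by simp

text \<open>The dual basis of \<open>B\<close>, extended to linear functionals \<open>g b\<close> on
  the ambient space, is bounded on \<open>S\<close>. So the integral coordinates of a lattice point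
  in \<open>S\<close> have only finitely many possible values.\<close>

lemma finite_lattice_Int_bounded:
  fixes N :: "'a::euclidean_space set"
  assumes "lattice_of_rank n N" "bounded S"
  shows "finite (N \<inter> S)"
proof -
  obtain B where B: "independent B" "N = {\<Sum>b\<in>B. real_of_int (c b) *\<^sub>R b |c. True}"
    using assms(1) unfolding lattice_of_rank_def by blast
  have "finite B" using B(1) by (rule independent_imp_finite)
  have "\<exists>g. linear g \<and> (\<forall>b'\<in>B. g b' = (if b' = b then 1 else 0 :: real))" for b
    by (rule linear_independent_extend[OF B(1), of "\<lambda>b'. if b' = b then 1 else 0"])
  then have "\<forall>b. \<exists>g. linear g \<and> (\<forall>b'\<in>B. g b' = (if b' = b then 1 else 0 :: real))" by simp
  from choice[OF this]
  obtain g where g: "\<And>b. linear (g b)" "\<And>b b'. b' \<in> B \<Longrightarrow> g b b' = (if b' = b then 1 else 0 :: real)"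
    by blast
  have coord: "g b (\<Sum>b'\<in>B. real_of_int (c b') *\<^sub>R b') = real_of_int (c b)" if "b \<in> B" for b c
  proof -
    have "g b (\<Sum>b'\<in>B. real_of_int (c b') *\<^sub>R b') = (\<Sum>b'\<in>B. real_of_int (c b') * g b b')"
      by (simp add: linear_sum[OF g(1)] linear_scale[OF g(1)])
    also have "\<dots> = (\<Sum>b'\<in>B. if b' = b then real_of_int (c b) else 0)"
      by (rule sum.cong) (auto simp: g(2))
    also have "\<dots> = real_of_int (c b)" using that \<open>finite B\<close> by simp
    finally show ?thesis .
  qed
  have "\<exists>m::int. \<forall>x\<in>S. \<bar>g b x\<bar> \<le> real_of_int m" for b
  proof -
    have "bounded (g b ` S)"
      using assms(2) g(1) by (simp add: bounded_linear_image linear_conv_bounded_linear)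
    then obtain K where "\<forall>x\<in>S. \<bar>g b x\<bar> \<le> K" by (auto simp: bounded_iff)
    then show ?thesis by (intro exI[of _ "\<lceil>K\<rceil>"]) (auto intro: order_trans)
  qed
  then have "\<forall>b. \<exists>m::int. \<forall>x\<in>S. \<bar>g b x\<bar> \<le> real_of_int m" by blast
  from choice[OF this]
  obtain m where m: "\<And>b x. x \<in> S \<Longrightarrow> \<bar>g b x\<bar> \<le> real_of_int (m b)"
    by blast
  have "N \<inter> S \<subseteq> (\<lambda>c. \<Sum>b\<in>B. real_of_int (c b) *\<^sub>R b) ` PiE B (\<lambda>b. {- m b..m b})"
  proof
    fix x assume x: "x \<in> N \<inter> S"
    then obtain c where c: "x = (\<Sum>b\<in>B. real_of_int (c b) *\<^sub>R b)" using B(2) by blast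
    have "\<bar>real_of_int (c b)\<bar> \<le> real_of_int (m b)" if "b \<in> B" for b
      using m[of x b] x coord[OF that, of c] c by simp
    then have "\<bar>c b\<bar> \<le> m b" if "b \<in> B" for b
      using that by fastforce
    then have "restrict c B \<in> PiE B (\<lambda>b. {- m b..m b})"
      by (fastforce simp: abs_le_iff)
    moreover have "x = (\<Sum>b\<in>B. real_of_int (restrict c B b) *\<^sub>R b)"
      unfolding c by (rule sum.cong) auto
    ultimately show "x \<in> (\<lambda>c. \<Sum>b\<in>B. real_of_int (c b) *\<^sub>R b) ` PiE B (\<lambda>b. {- m b..m b})"
      by blast
  qed
  moreover have "finite (PiE B (\<lambda>b. {- m b..m b}))"
    using \<open>finite B\<close> by (intro finite_PiE) auto
  ultimately show ?thesis using finite_surj by blast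
qed

lemma sum_multiples_mem_nat_span:
  assumes "w \<in> W" "distinct vs"
  shows "w + (\<Sum>v\<in>set vs. real (k v) *\<^sub>R v) \<in> nat_span W vs"
  using assms(2)
proof (induction vs)
  case (Cons v vs)
  then have "w + (\<Sum>v\<in>set vs. real (k v) *\<^sub>R v) \<in> nat_span W vs" by simp
  moreover have "w + (\<Sum>v\<in>set (v # vs). real (k v) *\<^sub>R v) =
      w + (\<Sum>v\<in>set vs. real (k v) *\<^sub>R v) + real (k v) *\<^sub>R v"
    using Cons.prems by (simp add: algebra_simps)
  ultimately show ?case unfolding nat_span.simps by blast
qed (use assms in simp)

text \<open>The midpoint of \<open>x\<close> and \<open>y\<close> is relatively interior, and
  doubling maps the cone, hence its relative interior, onto itself. This makes the interior lattice
  points a submodule of all lattice points of the cone.\<close>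

lemma rel_interior_convex_cone_add:
  fixes \<sigma> :: "'a::euclidean_space set"
  assumes "convex_cone \<sigma>" "x \<in> rel_interior \<sigma>" "y \<in> \<sigma>"
  shows "x + y \<in> rel_interior \<sigma>"
proof -
  have "y - (1/2) *\<^sub>R (y - x) \<in> rel_interior \<sigma>"
    by (rule rel_interior_convex_shrink) (use assms in \<open>auto simp: convex_cone_def\<close>)
  moreover have "y - (1/2) *\<^sub>R (y - x) = (1/2) *\<^sub>R (x + y)"
    by (simp add: algebra_simps flip: scaleR_add_left)
  ultimately have "(1/2) *\<^sub>R (x + y) \<in> rel_interior \<sigma>" by simp
  then have "2 *\<^sub>R (1/2) *\<^sub>R (x + y) \<in> (*\<^sub>R) 2 ` rel_interior \<sigma>" by (rule imageI)
  also have "(*\<^sub>R) 2 ` rel_interior \<sigma> = rel_interior ((*\<^sub>R) 2 ` \<sigma>)"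
    by (rule rel_interior_scaleR) simp
  also have "(*\<^sub>R) 2 ` \<sigma> = \<sigma>"
  proof (intro equalityI subsetI)
    fix z assume "z \<in> \<sigma>"
    then have "(1/2) *\<^sub>R z \<in> \<sigma>" using assms(1) by (simp add: convex_cone_scaleR)
    then show "z \<in> (*\<^sub>R) 2 ` \<sigma>" by (rule rev_image_eqI) simp
  qed (use convex_cone_scaleR[OF assms(1), of 2] in auto)
  finally show ?thesis by simp
qed

text \<open>Split each coefficient of a lattice point of the cone into integral and fractional part.
  The integral parts give an element of the monoid spanned by \<open>vs\<close>; the rest is a
  difference of lattice points lying in the bounded set \<open>S\<close>, so
  \<open>W = N \<inter> S\<close> is finite and suffices.\<close>

lemma gordan:
  fixes N :: "'a::euclidean_space set"
  assumes "lattice_of_rank n N" "set vs \<subseteq> N" "distinct vs"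
  obtains W where "finite W" "W \<subseteq> convex_cone hull set vs \<inter> N"
    "convex_cone hull set vs \<inter> N \<subseteq> nat_span W vs"
proof -
  let ?V = "set vs" and ?\<sigma> = "convex_cone hull set vs"
  define S where "S = {\<Sum>v\<in>?V. c v *\<^sub>R v |c. \<forall>v\<in>?V. 0 \<le> c v \<and> c v \<le> 1}"
  have "bounded S"
    unfolding bounded_iff
  proof (intro exI ballI)
    fix x assume "x \<in> S"
    then obtain c where c: "x = (\<Sum>v\<in>?V. c v *\<^sub>R v)" "\<forall>v\<in>?V. 0 \<le> c v \<and> c v \<le> 1"
      unfolding S_def by blast
    have "norm x \<le> (\<Sum>v\<in>?V. norm (c v *\<^sub>R v))" unfolding c(1) by (rule norm_sum)
    also have "\<dots> \<le> (\<Sum>v\<in>?V. norm v)"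
      using c(2) by (intro sum_mono) (simp add: mult_left_le_one_le)
    finally show "norm x \<le> (\<Sum>v\<in>?V. norm v)" .
  qed
  then have "finite (N \<inter> S)" by (rule finite_lattice_Int_bounded[OF assms(1)])
  moreover have "S \<subseteq> ?\<sigma>"
    unfolding S_def convex_cone_hull_finite[OF finite_set] by blast
  moreover have "?\<sigma> \<inter> N \<subseteq> nat_span (N \<inter> S) vs"
  proof
    fix x assume x: "x \<in> ?\<sigma> \<inter> N"
    then obtain c where c: "x = (\<Sum>v\<in>?V. c v *\<^sub>R v)" "\<forall>v\<in>?V. 0 \<le> c v"
      unfolding convex_cone_hull_finite[OF finite_set] by blast
    define k where "k v = nat \<lfloor>c v\<rfloor>" for v
    let ?w = "\<Sum>v\<in>?V. (c v - real (k v)) *\<^sub>R v" and ?s = "\<Sum>v\<in>?V. real (k v) *\<^sub>R v"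
    have "real (k v) = of_int \<lfloor>c v\<rfloor>" if "v \<in> ?V" for v
      using c(2) that by (simp add: k_def)
    then have "0 \<le> c v - real (k v) \<and> c v - real (k v) \<le> 1" if "v \<in> ?V" for v
      using that by (simp; linarith)
    then have "?w \<in> S"
      unfolding S_def by (intro CollectI exI[of _ "\<lambda>v. c v - real (k v)"]) blast
    have xw: "x = ?w + ?s" by (simp add: c(1) algebra_simps flip: sum.distrib)
    have "?s \<in> nat_span {0} vs"
      using sum_multiples_mem_nat_span[of 0 "{0}" vs k] assms(3) by simp
    also have "nat_span {0} vs \<subseteq> N"
      by (rule nat_span_subset)
         (use assms(1,2) zero_mem_lattice lattice_add in blast)+
    finally have "?w \<in> N" using lattice_diff[OF assms(1), of x ?s] x xw by simp
    then show "x \<in> nat_span (N \<inter> S) vs"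
      unfolding xw using \<open>?w \<in> S\<close> assms(3) by (intro sum_multiples_mem_nat_span) auto
  qed
  ultimately show ?thesis using that[of "N \<inter> S"] by blast
qed

section \<open>From generating functions to poles of the zeta function\<close>

text \<open>Identity theorem: outside a sparse set the meromorphic function \<open>F - G\<close> is
  either zero throughout or nowhere zero, and its vanishing on \<open>A\<close> excludes the latter.
  So \<open>F\<close> and \<open>G\<close> agree on a punctured neighbourhood of every point, which
  determines the poles.\<close>

lemma is_pole_transfer:
  assumes "F meromorphic_on UNIV" "G meromorphic_on UNIV" "open A" "A \<noteq> {}"
    and eq: "\<And>s. s \<in> A \<Longrightarrow> F s = G s" and "is_pole F s"
  shows "is_pole G s"
proof -
  let ?h = "\<lambda>s. F s - G s"
  obtain a where "a \<in> A" using assms(4) by blast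
  have ev_A: "\<forall>\<^sub>F s in at a. s \<in> A"
    using \<open>open A\<close> \<open>a \<in> A\<close> by (rule eventually_at_in_open')
  have "?h meromorphic_on UNIV" using assms(1,2) by (intro meromorphic_intros)
  then consider "eventually (\<lambda>s. ?h s = 0) (cosparse UNIV)"
    | "eventually (\<lambda>s. ?h s \<noteq> 0) (cosparse UNIV)"
    using meromorphic_imp_constant_or_avoid[of ?h UNIV 0] by auto
  then have "eventually (\<lambda>s. ?h s = 0) (cosparse UNIV)"
  proof cases
    case 2
    then have "\<forall>\<^sub>F s in at a. ?h s \<noteq> 0" by (simp add: eventually_cosparse_open_eq)
    with ev_A have "\<forall>\<^sub>F s in at a. False" by eventually_elim (use eq in auto)
    then show ?thesis by simp
  qed
  then have "\<forall>\<^sub>F w in at s. F w = G w" by (simp add: eventually_cosparse_open_eq)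
  then show ?thesis using assms(6) is_pole_cong[of F G s s] by blast
qed

text \<open>Gordan's lemma and the Noetherian property make the interior lattice points
  \<open>A\<close> a finitely generated module, to which \<open>hilbert_serre\<close> applies with
  \<open>B = {}\<close>.\<close>

lemma cone_generating_function:
  fixes N \<sigma> :: "'a::euclidean_space set"
  assumes N: "lattice_of_rank n N" and vs: "set vs \<subseteq> N" "distinct vs"
    and \<sigma>: "\<sigma> = convex_cone hull set vs"
    and z: "\<And>u v. u \<in> \<sigma> \<inter> N \<Longrightarrow> v \<in> \<sigma> \<inter> N \<Longrightarrow> z (u + v) = z u * z v"
    and d: "\<And>u v. u \<in> \<sigma> \<inter> N \<Longrightarrow> v \<in> \<sigma> \<inter> N \<Longrightarrow> d (u + v) = d u + d v"
    and less1: "\<And>v. v \<in> set vs \<Longrightarrow> norm (z v) < 1"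
  shows "\<exists>P. \<forall>T\<in>ball 0 1. (\<Prod>v\<leftarrow>vs. 1 - z v * T ^ d v) *
    (\<Sum>\<^sub>\<infinity>a\<in>rel_interior \<sigma> \<inter> N. z a * T ^ d a) = poly P (T :: complex)"
proof -
  have cone: "convex_cone \<sigma>" unfolding \<sigma> by (rule convex_cone_convex_cone_hull)
  have M: "u + v \<in> \<sigma> \<inter> N" if "u \<in> \<sigma> \<inter> N" "v \<in> \<sigma> \<inter> N" for u v
    using that convex_cone_add[OF cone] lattice_add[OF N] by blast
  have vsM: "set vs \<subseteq> \<sigma> \<inter> N" using vs hull_subset[of "set vs" convex_cone] \<sigma> by blast
  obtain W where W: "finite W" "W \<subseteq> \<sigma> \<inter> N" "\<sigma> \<inter> N \<subseteq> nat_span W vs"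
    using gordan[OF N vs] \<sigma> by metis
  define A where "A = rel_interior \<sigma> \<inter> N"
  have A: "A \<subseteq> \<sigma> \<inter> N" using rel_interior_subset by (auto simp: A_def)
  have A_closed: "a + v \<in> A" if "a \<in> A" "v \<in> set vs" for a v
  proof -
    have "v \<in> \<sigma>" "v \<in> N" using that vsM by auto
    then show ?thesis
      using that rel_interior_convex_cone_add[OF cone] lattice_add[OF N] by (auto simp: A_def)
  qed
  obtain W' where W': "finite W'" "W' \<subseteq> A" "A \<subseteq> nat_span W' vs"
    by (rule nat_span_noetherian[of A W vs]) (use A W A_closed in auto)
  have summ: "(\<lambda>a. z a * T ^ d a) summable_on \<sigma> \<inter> N" if T: "T \<in> ball 0 1" for T
  proof -
    have "(\<lambda>a. norm (z a * T ^ d a)) summable_on nat_span W vs"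
    proof (rule nat_span_norm_summable[OF M _ W(1,2) vsM])
      fix v assume "v \<in> set vs"
      \<comment> \<open>Strict inequality has to come from \<open>z v\<close>, because
        \<open>d v\<close> may be 0.\<close>
      have "norm T ^ d v \<le> 1" using T by (intro power_le_one) auto
      then have "norm (z v * T ^ d v) \<le> norm (z v)"
        by (simp add: norm_mult norm_power mult_left_le)
      then show "norm (z v * T ^ d v) < 1" using less1[OF \<open>v \<in> set vs\<close>] by simp
    qed (use z d in \<open>auto simp: power_add\<close>)
    then show ?thesis
      by (rule summable_on_subset_banach[OF abs_summable_summable W(3)])
  qed
  have "\<exists>P. \<forall>T\<in>ball 0 1. (\<Prod>v\<leftarrow>vs. 1 - z v * T ^ d v) *
    (\<Sum>\<^sub>\<infinity>a\<in>A - {}. z a * T ^ d a) = poly P T"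
    by (rule hilbert_serre[OF M d z summ vsM A W'(1,2)]) (use W'(3) A_closed in auto)
  then show ?thesis by (simp add: A_def)
qed

theorem theorem1p3:
  fixes p n :: nat
    and N \<sigma> :: "'a::euclidean_space set"
    and l1 l2 :: "'a \<Rightarrow> real"
  assumes "prime p"
    and "lattice_of_rank n N"
    and "rational_polyhedral_cone N \<sigma>" and "pointed_cone \<sigma>"
    and "l1 \<in> dual_cone \<sigma> \<inter> dual_lattice N" and "l2 \<in> dual_cone \<sigma> \<inter> dual_lattice N"
    and "\<sigma> \<inter> {v. l2 v = 0} = {0}"
  shows "rational_function_of_on (cone_zeta p N \<sigma> l1 l2)
           (\<lambda>s. (1 / of_nat p :: complex) powr s) {s. Re s > 0} \<and>
         (\<exists>F. meromorphic_extension F (cone_zeta p N \<sigma> l1 l2) {s. Re s > 0}) \<and>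
         (\<forall>F. meromorphic_extension F (cone_zeta p N \<sigma> l1 l2) {s. Re s > 0} \<longrightarrow>
           (\<forall>s. is_pole F s \<longrightarrow>
             (\<exists>\<rho> v. ray_of \<rho> \<sigma> \<and> primitive_generator N \<rho> v \<and> l1 v \<noteq> 0 \<and>
                    Re s = - (l2 v / l1 v))))"
proof -
  define q where "q = 1 / real p"
  have q: "0 < q" "q < 1" using prime_gt_1_nat[OF assms(1)] by (auto simp: q_def)
  have lin: "linear l1" "linear l2" using assms(5,6) by (auto simp: dual_cone_def)
  have int: "l1 v \<in> \<int>" "l2 v \<in> \<int>" if "v \<in> N" for v
    using assms(5,6) that by (auto simp: dual_lattice_def)
  have nonneg: "l1 v \<ge> 0" "l2 v \<ge> 0" if "v \<in> \<sigma>" for v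
    using assms(5,6) that by (auto simp: dual_cone_def)
  have pos: "l2 v > 0" if "v \<in> \<sigma>" "v \<noteq> 0" for v
  proof -
    have "l2 v \<noteq> 0" using assms(7) that by blast
    with nonneg(2)[OF that(1)] show ?thesis by simp
  qed
  obtain V where V: "finite V" "V \<subseteq> N" "\<sigma> = convex_cone hull V"
    "\<forall>v\<in>V. v \<noteq> 0 \<and> (\<exists>\<rho>. ray_of \<rho> \<sigma> \<and> primitive_generator N \<rho> v)"
    by (rule cone_primitive_generators[OF assms(3) zero_mem_lattice[OF assms(2)]
          lattice_diff[OF assms(2)] lin(2) int(2) pos])
  obtain vs where vs: "set vs = V" "distinct vs" using finite_distinct_list[OF V(1)] by blast
  have V\<sigma>: "v \<in> \<sigma>" if "v \<in> V" for v using that V(3) hull_inc by metis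
  \<comment> \<open>On \<open>\<sigma> \<inter> N\<close> both functionals take nonnegative integer
    values, so the floors are exact, and the zeta function becomes a power series in
    \<open>T = g s\<close> with coefficients built from \<open>z\<close>.\<close>
  define d where "d v = nat \<lfloor>l1 v\<rfloor>" for v
  define e where "e v = nat \<lfloor>l2 v\<rfloor>" for v
  have de: "real (d v) = l1 v" "real (e v) = l2 v" if "v \<in> \<sigma> \<inter> N" for v
    using int[of v] nonneg[of v] that by (auto simp: d_def e_def elim!: Ints_cases)
  have add: "d (u + v) = d u + d v" "e (u + v) = e u + e v"
    if "u \<in> \<sigma> \<inter> N" "v \<in> \<sigma> \<inter> N" for u v
  proof -
    have "u + v \<in> \<sigma> \<inter> N"
      using that lattice_add[OF assms(2)] convex_cone_hull_add V(3) by blast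
    then have "real (d (u + v)) = real (d u + d v)" "real (e (u + v)) = real (e u + e v)"
      using de that lin by (simp_all add: linear_add)
    then show "d (u + v) = d u + d v" "e (u + v) = e u + e v" by (simp_all only: of_nat_eq_iff)
  qed
  define z :: "'a \<Rightarrow> complex" where "z v = of_real q ^ e v" for v
  define g :: "complex \<Rightarrow> complex" where "g s = (1 / of_nat p) powr s" for s
  have norm_g: "norm (g s) = q powr Re s" for s
    unfolding g_def using norm_powr_real_powr[of "complex_of_real q" s] q
    by (simp add: q_def)
  have norm_factor: "norm (z v * g s ^ d v) = q powr (l2 v + l1 v * Re s)" if "v \<in> V" for v s
  proof -
    have v: "v \<in> \<sigma> \<inter> N" using that V V\<sigma> by blast
    have "norm (z v * g s ^ d v) = q powr real (e v) * q powr (real (d v) * Re s)"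
      using q by (simp add: z_def norm_mult norm_power norm_g powr_realpow powr_power mult.commute)
    then show ?thesis using de[OF v] by (simp add: powr_add)
  qed
  have "\<exists>P. \<forall>T\<in>ball 0 1. (\<Prod>v\<leftarrow>vs. 1 - z v * T ^ d v) *
      (\<Sum>\<^sub>\<infinity>a\<in>rel_interior \<sigma> \<inter> N. z a * T ^ d a) = poly P T"
  proof (rule cone_generating_function[OF assms(2)])
    fix v assume "v \<in> set vs"
    then have v: "v \<in> \<sigma> \<inter> N" "l2 v > 0" using V V\<sigma> vs pos by auto
    then have "e v > 0" using de(2)[OF v(1)] by linarith
    then show "norm (z v) < 1" using q by (simp add: z_def norm_power power_less_one_iff)
  qed (use V vs add in \<open>auto simp: z_def power_add\<close>)
  then obtain P where P: "\<And>T. norm T < 1 \<Longrightarrow> (\<Prod>v\<leftarrow>vs. 1 - z v * T ^ d v) *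
      (\<Sum>\<^sub>\<infinity>a\<in>rel_interior \<sigma> \<inter> N. z a * T ^ d a) = poly P T"
    by auto
  \<comment> \<open>A factor with \<open>d v = 0\<close> is the constant \<open>1 - z v\<close>,
    which is nonzero because \<open>norm (z v) < 1\<close>; such rays contribute no zeros.\<close>
  define Q where "Q = (\<Prod>v\<leftarrow>vs. 1 - monom (z v) (d v))"
  have Q: "poly Q T = (\<Prod>v\<leftarrow>vs. 1 - z v * T ^ d v)" for T
    unfolding Q_def by (induction vs) (simp_all add: poly_monom)
  have Q_zero: "\<exists>v\<in>V. l2 v + l1 v * Re s = 0" if zero: "poly Q (g s) = 0" for s
  proof -
    \<comment> \<open>Taking norms, a power of \<open>q\<close> equals 1. As
      \<open>0 < q < 1\<close>, the exponent must be 0.\<close>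
    obtain v where v: "v \<in> V" "z v * g s ^ d v = 1"
      using zero vs by (auto simp: Q prod_list_zero_iff)
    then have "q powr (l2 v + l1 v * Re s) = 1" using norm_factor[OF v(1), of s] by simp
    then show ?thesis using v q by (auto simp: powr_eq_one_iff_gen)
  qed
  have Q_nz: "poly Q (g s) \<noteq> 0" if "Re s > 0" for s
  proof
    assume "poly Q (g s) = 0"
    then obtain v where v: "v \<in> V" "l2 v + l1 v * Re s = 0" using Q_zero by blast
    then have "l2 v > 0" "l1 v * Re s \<ge> 0" using V(4) V\<sigma> pos nonneg that by auto
    with v show False by simp
  qed
  define G where "G s = poly P (g s) / poly Q (g s)" for s
  have zeta: "cone_zeta p N \<sigma> l1 l2 s = G s" if "Re s > 0" for s
  proof -
    have "cone_zeta p N \<sigma> l1 l2 s = (\<Sum>\<^sub>\<infinity>a\<in>rel_interior \<sigma> \<inter> N. z a * g s ^ d a)"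
      unfolding cone_zeta_def
    proof (rule infsum_cong)
      fix v assume "v \<in> rel_interior \<sigma> \<inter> N"
      then have v: "v \<in> \<sigma> \<inter> N" using rel_interior_subset by auto
      let ?c = "1 / of_nat p :: complex"
      have c: "?c \<noteq> 0" "?c = of_real q" using prime_gt_0_nat[OF assms(1)] by (auto simp: q_def)
      \<comment> \<open>Because \<open>d v\<close> and \<open>e v\<close> are natural numbers, the
        exponentials become ordinary powers without any issue of branches.\<close>
      have "?c powr (of_real (l1 v) * s + of_real (l2 v)) =
          exp (of_nat (d v) * (s * Ln ?c)) * exp (of_nat (e v) * Ln ?c)"
        using c(1) by (simp add: powr_def de[OF v, symmetric] exp_add algebra_simps)
      also have "\<dots> = g s ^ d v * ?c ^ e v"
        unfolding exp_of_nat_mult using c(1) by (simp add: g_def powr_def)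
      finally show "?c powr (of_real (l1 v) * s + of_real (l2 v)) = z v * g s ^ d v"
        using c(2) by (simp add: z_def)
    qed
    moreover have "norm (g s) < 1"
      unfolding norm_g using powr_less_mono2[of "Re s" q 1] q that by simp
    ultimately show ?thesis
      using P[of "g s"] Q_nz[OF that] by (simp add: G_def Q field_simps)
  qed
  have "(\<lambda>s. poly R (g s)) analytic_on UNIV" for R
  proof -
    have "g = (\<lambda>s. exp (s * Ln (1 / of_nat p)))"
      using prime_gt_0_nat[OF assms(1)] by (auto simp: g_def powr_def)
    then have "g analytic_on UNIV" by (auto intro!: analytic_intros)
    then show ?thesis unfolding poly_altdef by (intro analytic_intros)
  qed
  then have poly_g: "(\<lambda>s. poly R (g s)) analytic_on A" for R A
    using analytic_on_subset by blast
  have mero: "G meromorphic_on UNIV"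
    unfolding G_def by (intro meromorphic_intros analytic_on_imp_meromorphic_on poly_g)
  have poles: "\<exists>\<rho> v. ray_of \<rho> \<sigma> \<and> primitive_generator N \<rho> v \<and> l1 v \<noteq> 0 \<and> Re s = - (l2 v / l1 v)"
    if F: "meromorphic_extension F (cone_zeta p N \<sigma> l1 l2) {s. Re s > 0}" "is_pole F s" for F s
  proof -
    \<comment> \<open>An arbitrary extension \<open>F\<close> is prescribed only on the half-plane;
      its poles are controlled through the explicit extension \<open>G\<close>.\<close>
    have "is_pole G s"
    proof (rule is_pole_transfer[OF _ mero open_halfspace_Re_gt[of 0] _ _ F(2)])
      show "{s. 0 < Re s} \<noteq> {}" by (auto intro: exI[of _ 1])
    qed (use F(1) zeta in \<open>auto simp: meromorphic_extension_def\<close>)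
    moreover have "\<not> is_pole G s" if "poly Q (g s) \<noteq> 0"
      unfolding G_def using that
      by (intro analytic_at_imp_no_pole analytic_on_divide poly_g) auto
    ultimately obtain v where v: "v \<in> V" "l2 v + l1 v * Re s = 0" using Q_zero by blast
    \<comment> \<open>If \<open>l1 v\<close> were 0, the equation
      \<open>l2 v + l1 v * Re s = 0\<close> would give \<open>l2 v = 0\<close>.\<close>
    have "l2 v > 0" using v V(4) V\<sigma> pos by blast
    then have "l1 v \<noteq> 0" using v(2) by auto
    moreover from this have "Re s = - (l2 v / l1 v)" using v(2) by (simp add: field_simps)
    ultimately show ?thesis using V(4) v(1) by blast
  qed
  have "Q \<noteq> 0" using Q_nz[of 1] by auto
  then have "rational_function_of_on (cone_zeta p N \<sigma> l1 l2) g {s. Re s > 0}"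
    unfolding rational_function_of_on_def
    by (intro exI[of _ P] exI[of _ Q]) (auto simp: Q_nz zeta G_def)
  moreover have "meromorphic_extension G (cone_zeta p N \<sigma> l1 l2) {s. Re s > 0}"
    using mero zeta by (simp add: meromorphic_extension_def)
  moreover have "(\<lambda>s. (1 / of_nat p) powr s) = g" by (simp add: fun_eq_iff g_def)
  ultimately show ?thesis using poles by auto
qed

end
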